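(* Consider the Gaussian channel described in the context, with channel power gains $g_1^p,g_2^p,g_s^p,g_1^s,g_2^s,g_s^s>0$, powers $P_1,P_2,P_s>0$ and noise variance $N_0>0$. Let $i\in\{1,2\}$ and let $j\in\{1,2\}$, $j\ne i$. For $\lambda\in[0,1]$ let $Z=Z_\lambda$ be the element of $\mathcal{G}(P_1,P_2,P_s)$ with $U$ of variance $\lambda P_s$ and $W$ of variance $(1-\lambda)P_s$. Then $\mathcal{R}^r_i(Z)=\mathcal{R}^r_{ig}$ if and only if $\lambda=0$ and $$I(Y_s;W|X_i)\le I(Y_p;W|X_1X_2),$$ the last inequality being equivalent (at $\lambda=0$) to $$g_s^sN_0\le g_s^p\,(g_j^sP_j+N_0).$$
   Context: Gaussian channel: real inputs $x_1,x_2,x_s$ and outputs $$y_p=\sqrt{g_1^p}\,x_1+\sqrt{g_2^p}\,x_2+\sqrt{g_s^p}\,x_s+n_p,\qquad y_s=\sqrt{g_1^s}\,x_1+\sqrt{g_2^s}\,x_2+\sqrt{g_s^s}\,x_s+n_s,$$ where $n_p,n_s$ are independent zero-mean Gaussian noises of variance $N_0$, independent of the inputs. $\mathcal{G}(P_1,P_2,P_s)$ is the set of $Z=UWX_1X_2X_sY_pY_s$ (time-sharing variable $Q$ constant, hence omitted) where $X_1,X_2,U,W$ are independent zero-mean Gaussian random variables, $X_s=U+W$, $\mathrm{Var}(X_1)=P_1$, $\mathrm{Var}(X_2)=P_2$, $\mathrm{Var}(X_s)=P_s$, and $Y_p,Y_s$ are the corresponding channel outputs. Thus the elements are parametrized by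 $\lambda\in[0,1]$ via $\mathrm{Var}(U)=\lambda P_s$, $\mathrm{Var}(W)=(1-\lambda)P_s$ (a zero-variance Gaussian being the constant $0$). $\mathcal{R}_i^r(Z)$ is the set of all pairs $(R_s,R_p)=(S+T,\,R_1+R_2)$ with $(R_1,R_2,S,T)$ nonnegative reals satisfying $$R_1\le I(Y_p;X_1|WX_2),\quad R_2\le I(Y_p;X_2|WX_1),\quad T\le I(Y_p;W|X_1X_2),\quad R_1+R_2\le I(Y_p;X_1X_2|W),$$ $$R_1+T\le I(Y_p;WX_1|X_2),\quad R_2+T\le I(Y_p;WX_2|X_1),\quad R_1+R_2+T\le I(Y_p;WX_1X_2),$$ $$S\le I(Y_s;U|WX_i),\quad T\le I(Y_s;W|UX_i),\quad R_i\le I(Y_s;X_i|UW),\quad S+T\le I(Y_s;UW|X_i),$$ $$R_i+S\le I(Y_s;UX_i|W),\quad R_i+T\le I(Y_s;WX_i|U),\quad R_i+S+T\le I(Y_s;UWX_i).$$ $\mathcal{R}^r_{ig}$ is the closure of $\bigcup_{Z\in\mathcal{G}(P_1,P_2,P_s)}\mathcal{R}_i^r(Z)$. *)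

theory Defs
  imports "HOL-Probability.Probability"
begin

datatype tx = T1 | T2 | TS

datatype rv = VU | VW | VX tx | VYp | VYs

text \<open>
  A tuple of random variables \<open>Z = U W X\<^sub>1 X\<^sub>2 X\<^sub>s Y\<^sub>p Y\<^sub>s\<close> is represented by its joint
  distribution: a probability measure on the functions \<open>rv \<Rightarrow> real\<close>, with \<open>\<lambda>z. z v\<close> being the
  random variable named \<open>v\<close>. Thus there is no ambient sample space whose richness could matter.
\<close>

type_synonym rvs = "(rv \<Rightarrow> real) measure"

abbreviation joint_space :: "rv set \<Rightarrow> (rv \<Rightarrow> real) measure" where
  "joint_space A \<equiv> Pi\<^sub>M A (\<lambda>_. borel)"

text \<open>
  \<open>mi b Z A B\<close> is \<open>I(A; B)\<close> and \<open>cmi b Z A B C\<close> is \<open>I(A; B | C)\<close>, for finite sets of variables,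
  with logarithms to base \<open>b\<close>. The library defines the conditional one by the chain rule, as
  \<open>I(A; B, C) - I(A; C)\<close>; it is only used with \<open>A\<close> a single noisy output, where both terms are
  finite, also if one of the variables in \<open>B\<close> or \<open>C\<close> is constant.
\<close>

definition mi :: "real \<Rightarrow> rvs \<Rightarrow> rv set \<Rightarrow> rv set \<Rightarrow> real" where
  "mi b Z A B = prob_space.mutual_information Z b (joint_space A) (joint_space B)
     (\<lambda>z. restrict z A) (\<lambda>z. restrict z B)"

definition cmi :: "real \<Rightarrow> rvs \<Rightarrow> rv set \<Rightarrow> rv set \<Rightarrow> rv set \<Rightarrow> real" where
  "cmi b Z A B C = prob_space.conditional_mutual_information Z b
     (joint_space A) (joint_space B) (joint_space C)
     (\<lambda>z. restrict z A) (\<lambda>z. restrict z B) (\<lambda>z. restrict z C)"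

text \<open>The constant 0 counts as a Gaussian, of variance 0.\<close>

definition zero_mean_gaussian :: "'a measure \<Rightarrow> ('a \<Rightarrow> real) \<Rightarrow> bool" where
  "zero_mean_gaussian M V \<longleftrightarrow>
     (AE x in M. V x = 0) \<or> (\<exists>\<sigma>>0. distributed M lborel V (normal_density 0 \<sigma>))"

text \<open>
  The noise at output \<open>y\<close> with power gains \<open>g\<close>, recovered from the channel equation
  \<open>y = sqrt g\<^sub>1 x\<^sub>1 + sqrt g\<^sub>2 x\<^sub>2 + sqrt g\<^sub>s x\<^sub>s + n\<close>.
\<close>

definition noise :: "(tx \<Rightarrow> real) \<Rightarrow> rv \<Rightarrow> (rv \<Rightarrow> real) \<Rightarrow> real" where
  "noise g y z = z y - (sqrt (g T1) * z (VX T1) + sqrt (g T2) * z (VX T2) + sqrt (g TS) * z (VX TS))"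

text \<open>
  The set \<open>\<G>(P\<^sub>1, P\<^sub>2, P\<^sub>s)\<close> for the channel with gains \<open>gp\<close>, \<open>gs\<close> and noise variance \<open>N0\<close>.
  The noises are independent of \<open>X\<^sub>1, X\<^sub>2, U, W\<close> jointly.
\<close>

definition gaussian_rvs ::
  "(tx \<Rightarrow> real) \<Rightarrow> (tx \<Rightarrow> real) \<Rightarrow> real \<Rightarrow> (tx \<Rightarrow> real) \<Rightarrow> rvs set" where
  "gaussian_rvs gp gs N0 P = {Z.
     prob_space Z \<and> sets Z = sets (joint_space UNIV) \<and>
     prob_space.indep_vars Z (\<lambda>_. borel)
       (\<lambda>k. [\<lambda>z. z (VX T1), \<lambda>z. z (VX T2), \<lambda>z. z VU, \<lambda>z. z VW,
              noise gp VYp, noise gs VYs] ! k) {..<6::nat} \<and>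
     zero_mean_gaussian Z (\<lambda>z. z (VX T1)) \<and> zero_mean_gaussian Z (\<lambda>z. z (VX T2)) \<and>
     zero_mean_gaussian Z (\<lambda>z. z VU) \<and> zero_mean_gaussian Z (\<lambda>z. z VW) \<and>
     zero_mean_gaussian Z (noise gp VYp) \<and> zero_mean_gaussian Z (noise gs VYs) \<and>
     (AE z in Z. z (VX TS) = z VU + z VW) \<and>
     (\<forall>k. prob_space.variance Z (\<lambda>z. z (VX k)) = P k) \<and>
     prob_space.variance Z (noise gp VYp) = N0 \<and>
     prob_space.variance Z (noise gs VYs) = N0}"

text \<open>
  \<open>\<R>\<^sub>i\<^sup>r(Z)\<close>, as a set of pairs \<open>(R\<^sub>s, R\<^sub>p)\<close>. Only the values of \<open>R\<close> at \<open>T1\<close> and \<open>T2\<close> matter, and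
  \<open>i\<close> is meant to be one of these.
\<close>

definition rate_region :: "real \<Rightarrow> tx \<Rightarrow> rvs \<Rightarrow> (real \<times> real) set" where
  "rate_region b i Z = {(S + T, R T1 + R T2) | (R :: tx \<Rightarrow> real) S T.
     0 \<le> R T1 \<and> 0 \<le> R T2 \<and> 0 \<le> S \<and> 0 \<le> T \<and>
     R T1 \<le> cmi b Z {VYp} {VX T1} {VW, VX T2} \<and>
     R T2 \<le> cmi b Z {VYp} {VX T2} {VW, VX T1} \<and>
     T \<le> cmi b Z {VYp} {VW} {VX T1, VX T2} \<and>
     R T1 + R T2 \<le> cmi b Z {VYp} {VX T1, VX T2} {VW} \<and>
     R T1 + T \<le> cmi b Z {VYp} {VW, VX T1} {VX T2} \<and>
     R T2 + T \<le> cmi b Z {VYp} {VW, VX T2} {VX T1} \<and>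
     R T1 + R T2 + T \<le> mi b Z {VYp} {VW, VX T1, VX T2} \<and>
     S \<le> cmi b Z {VYs} {VU} {VW, VX i} \<and>
     T \<le> cmi b Z {VYs} {VW} {VU, VX i} \<and>
     R i \<le> cmi b Z {VYs} {VX i} {VU, VW} \<and>
     S + T \<le> cmi b Z {VYs} {VU, VW} {VX i} \<and>
     R i + S \<le> cmi b Z {VYs} {VU, VX i} {VW} \<and>
     R i + T \<le> cmi b Z {VYs} {VW, VX i} {VU} \<and>
     R i + S + T \<le> mi b Z {VYs} {VU, VW, VX i}}"

definition gaussian_region ::
  "real \<Rightarrow> tx \<Rightarrow> (tx \<Rightarrow> real) \<Rightarrow> (tx \<Rightarrow> real) \<Rightarrow> real \<Rightarrow> (tx \<Rightarrow> real) \<Rightarrow> (real \<times> real) set" where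
  "gaussian_region b i gp gs N0 P = closure (\<Union>Z\<in>gaussian_rvs gp gs N0 P. rate_region b i Z)"

end

theory Submission
  imports Defs
begin

text \<open>
  If \<open>Y = a(V) + N\<close> with \<open>N\<close> Gaussian and independent of \<open>V\<close>, and \<open>Y\<close> Gaussian, then
  \<open>(Y, V)\<close> has density \<open>\<phi>\<^sub>N(y - a(v)) / \<phi>\<^sub>Y(y)\<close> with respect to the product of its marginals,
  whatever the distribution of \<open>V\<close>, and so \<open>I(Y; V)\<close> is half the logarithm of
  \<open>Var Y / Var N\<close>. This evaluates all bounds, also when \<open>U\<close> or \<open>W\<close> is degenerate, and shows
  that the rate region of \<open>Z\<close> depends on \<open>\<lambda>\<close> only.

  For \<open>\<lambda> > 0\<close>, the private part \<open>U\<close> is noise at the primary receiver, so the largest primary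
  rate is strictly smaller than for \<open>\<lambda> = 0\<close>. For \<open>\<lambda> = 0\<close> the secondary rate is at most
  \<open>I(Y\<^sub>p; W | X\<^sub>1 X\<^sub>2)\<close>, while \<open>\<lambda> = 1\<close> attains \<open>I(Y\<^sub>s; U | X\<^sub>i)\<close>, so the inequality of the theorem is
  necessary. If it holds, every private rate can be transferred to the common message, and the
  closed region at \<open>\<lambda> = 0\<close> contains all others.
\<close>

subsection \<open>Centred Gaussian variables, possibly degenerate\<close>

text \<open>The variance is an explicit argument, so that sums and multiples reduce to arithmetic on
  variances, with the constant 0 included as \<open>v = 0\<close>.\<close>

definition gaussian_var :: "'a measure \<Rightarrow> ('a \<Rightarrow> real) \<Rightarrow> real \<Rightarrow> bool" where
  "gaussian_var M V v \<longleftrightarrow> V \<in> borel_measurable M \<and>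
     (if v = 0 then AE x in M. V x = 0
      else 0 < v \<and> distributed M lborel V (normal_density 0 (sqrt v)))"

lemma gaussian_var_nonneg: "gaussian_var M V v \<Longrightarrow> 0 \<le> v"
  by (auto simp: gaussian_var_def split: if_splits)

lemma gaussian_var_measurable: "gaussian_var M V v \<Longrightarrow> V \<in> borel_measurable M"
  by (auto simp: gaussian_var_def)

lemma gaussian_var_imp_zero_mean_gaussian:
  "gaussian_var M V v \<Longrightarrow> zero_mean_gaussian M V"
  by (auto simp: gaussian_var_def zero_mean_gaussian_def split: if_splits intro!: exI[of _ "sqrt v"])

context prob_space
begin

lemma variance_AE_0:
  fixes V :: "'a \<Rightarrow> real"
  assumes [measurable]: "V \<in> borel_measurable M" and V: "AE x in M. V x = 0"
  shows "variance V = 0"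
proof -
  have "expectation V = 0"
    using V by (subst integral_cong_AE[of _ _ "\<lambda>_. 0"]) auto
  then show ?thesis
    using V by (subst integral_cong_AE[of _ _ "\<lambda>_. 0"]) auto
qed

lemma zero_mean_gaussian_imp_gaussian_var:
  assumes V: "V \<in> borel_measurable M" "zero_mean_gaussian M V"
  shows "gaussian_var M V (variance V)"
  using V(2) unfolding zero_mean_gaussian_def
proof (elim disjE exE conjE)
  assume "AE x in M. V x = 0"
  then show ?thesis
    using V(1) variance_AE_0[of V] by (simp add: gaussian_var_def)
next
  fix \<sigma> :: real assume "0 < \<sigma>" "distributed M lborel V (normal_density 0 \<sigma>)"
  moreover from this have "variance V = \<sigma>\<^sup>2"
    by (rule normal_distributed_variance)
  ultimately show ?thesis
    using V(1) by (simp add: gaussian_var_def)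
qed

lemma gaussian_var_variance:
  assumes "gaussian_var M V v"
  shows "variance V = v"
proof (cases "v = 0")
  case True
  then show ?thesis using assms variance_AE_0[of V] by (auto simp: gaussian_var_def)
next
  case False
  then show ?thesis
    using assms normal_distributed_variance[of "sqrt v" V 0] by (auto simp: gaussian_var_def)
qed

lemma gaussian_var_scale:
  assumes "gaussian_var M V v"
  shows "gaussian_var M (\<lambda>x. c * V x) (c\<^sup>2 * v)"
proof (cases "c = 0 \<or> v = 0")
  case True
  then show ?thesis using assms by (auto simp: gaussian_var_def)
next
  case False
  then have v: "0 < v" "c \<noteq> 0" "distributed M lborel V (normal_density 0 (sqrt v))"
    using assms by (auto simp: gaussian_var_def)
  have "distributed M lborel (\<lambda>x. 0 + c * V x) (normal_density (0 + c * 0) (\<bar>c\<bar> * sqrt v))"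
    using v by (intro normal_density_affine) auto
  then show ?thesis
    using assms v by (auto simp: gaussian_var_def real_sqrt_mult)
qed

lemma gaussian_var_cong_AE:
  assumes V: "gaussian_var M V v" and [measurable]: "V' \<in> borel_measurable M"
    and ae: "AE x in M. V' x = V x"
  shows "gaussian_var M V' v"
proof (cases "v = 0")
  case True
  then show ?thesis using assms by (auto simp: gaussian_var_def elim: eventually_elim2)
next
  case False
  have [measurable]: "V \<in> borel_measurable M"
    using V by (rule gaussian_var_measurable)
  have "distr M lborel V' = distr M lborel V"
    using ae by (intro distr_cong_AE) auto
  then show ?thesis using False V by (auto simp: gaussian_var_def distributed_def)
qed

lemma gaussian_var_add:
  assumes V: "gaussian_var M V v" and W: "gaussian_var M W w" and ind: "indep_var borel V borel W"
  shows "gaussian_var M (\<lambda>x. V x + W x) (v + w)"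
proof -
  have [measurable]: "V \<in> borel_measurable M" "W \<in> borel_measurable M"
    using V W by (auto dest: gaussian_var_measurable)
  consider "v = 0" | "w = 0" | "0 < v" "0 < w"
    using gaussian_var_nonneg[OF V] gaussian_var_nonneg[OF W] by linarith
  then show ?thesis
  proof cases
    case 1
    then show ?thesis
      using V by (intro gaussian_var_cong_AE[of W _ "\<lambda>x. V x + W x"]) (auto simp: gaussian_var_def[of _ V] W)
  next
    case 2
    then show ?thesis
      using W by (intro gaussian_var_cong_AE[of V _ "\<lambda>x. V x + W x"]) (auto simp: gaussian_var_def[of _ W] V)
  next
    case 3
    then show ?thesis
      using V W add_indep_normal[OF ind, of "sqrt v" "sqrt w" 0 0]
      by (auto simp: gaussian_var_def)
  qed
qed

lemma gaussian_var_sum: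
  assumes "finite I" "indep_vars (\<lambda>_. borel) X I"
    and "\<And>k. k \<in> I \<Longrightarrow> gaussian_var M (X k) (v k)"
  shows "gaussian_var M (\<lambda>x. \<Sum>k\<in>I. X k x) (\<Sum>k\<in>I. v k)"
  using assms
proof (induction I rule: finite_induct)
  case empty
  then show ?case by (simp add: gaussian_var_def)
next
  case (insert i I)
  then have "gaussian_var M (\<lambda>x. X i x + (\<Sum>k\<in>I. X k x)) (v i + sum v I)"
    by (intro gaussian_var_add indep_vars_sum insert.IH) (auto intro: indep_vars_subset)
  then show ?case using insert by simp
qed

lemma gaussian_var_second_moment:
  assumes "0 < v" "gaussian_var M V v"
  shows "integrable M (\<lambda>x. (V x)\<^sup>2)" "expectation (\<lambda>x. (V x)\<^sup>2) = v"
proof -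
  have D: "distributed M lborel V (normal_density 0 (sqrt v))"
    using assms by (simp add: gaussian_var_def)
  have "integrable lborel (\<lambda>x. normal_density 0 (sqrt v) x * (x - 0)\<^sup>2)"
    using assms by (intro integrable_normal_moment) auto
  then show "integrable M (\<lambda>x. (V x)\<^sup>2)"
    by (subst distributed_integrable[OF D, symmetric]) auto
  have "expectation V = 0"
    using assms D by (intro normal_distributed_expectation[of "sqrt v"]) auto
  then show "expectation (\<lambda>x. (V x)\<^sup>2) = v"
    using gaussian_var_variance[OF assms(2)] by simp
qed

end

section \<open>Mutual information across additive Gaussian noise\<close>

lemma log_normal_density_quotient:
  assumes "1 < b" "0 < v" "0 < w"
  shows "log b (normal_density 0 (sqrt v) x / normal_density 0 (sqrt w) y)
    = log b (w / v) / 2 + (y\<^sup>2 / (2 * w) - x\<^sup>2 / (2 * v)) / ln b"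
proof -
  have "ln (normal_density 0 (sqrt v) x / normal_density 0 (sqrt w) y)
    = ln (w / v) / 2 + (y\<^sup>2 / (2 * w) - x\<^sup>2 / (2 * v))"
    using assms by (simp add: normal_density_def ln_div ln_mult ln_sqrt)
       (simp add: field_simps)
  then show ?thesis
    using assms by (simp add: log_def add_divide_distrib)
qed

text \<open>The encoding \<open>e\<close> with left inverse \<open>h\<close> lets the output be
  presented as a function on a one-element index set. Independence is stated as a product of
  distributions, so that \<open>V\<close> may have values of any type.\<close>

lemma (in prob_space) mutual_information_additive_gaussian:
  fixes N Y :: "'a \<Rightarrow> real" and V :: "'a \<Rightarrow> 'c" and a :: "'c \<Rightarrow> real" and e :: "real \<Rightarrow> 'd"
  assumes b: "1 < b"
    and V[measurable]: "V \<in> measurable M T" and a[measurable]: "a \<in> borel_measurable T"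
    and e[measurable]: "e \<in> measurable borel S" and h[measurable]: "h \<in> borel_measurable S"
    and he: "\<And>y. h (e y) = y"
    and N: "gaussian_var M N v" "0 < v" 
    and ind: "distr M borel N \<Otimes>\<^sub>M distr M T V = distr M (borel \<Otimes>\<^sub>M T) (\<lambda>x. (N x, V x))"
    and Y: "gaussian_var M Y w" "0 < w" and Y_eq: "AE x in M. Y x = a (V x) + N x"
  shows "mutual_information b S T (\<lambda>x. e (Y x)) V = log b (w / v) / 2"
proof -
  have [measurable]: "N \<in> borel_measurable M" "Y \<in> borel_measurable M"
    using N Y by (auto dest: gaussian_var_measurable)
  define f where "f = (\<lambda>(s, t). normal_density 0 (sqrt v) (h s - a t) / normal_density 0 (sqrt w) (h s))"
  have [measurable]: "f \<in> borel_measurable (S \<Otimes>\<^sub>M T)"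
    unfolding f_def by measurable
  let ?Y = "distr M S (\<lambda>x. e (Y x))" and ?V = "distr M T V"
  let ?J = "distr M (S \<Otimes>\<^sub>M T) (\<lambda>x. (e (Y x), V x))"
  interpret Yd: prob_space ?Y by (rule prob_space_distr) measurable
  interpret Vd: prob_space ?V by (rule prob_space_distr) measurable
  interpret Nd: prob_space "distr M borel N" by (rule prob_space_distr) measurable
  interpret P: pair_prob_space ?Y ?V ..
  interpret Q: pair_prob_space "distr M borel N" ?V ..
  have DN: "distr M lborel N = density lborel (normal_density 0 (sqrt v))"
    and DY: "distr M lborel Y = density lborel (normal_density 0 (sqrt w))"
    using N Y by (auto simp: gaussian_var_def distributed_def)
  \<comment> \<open>Given \<open>V = t\<close>, the output is the noise shifted by
    \<open>a t\<close>; dividing its density by that of \<open>Y\<close> gives the density relative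
    to the product of the marginals.\<close>
  have J: "?J = density (?Y \<Otimes>\<^sub>M ?V) f"
  proof (rule measure_eqI)
    show "sets ?J = sets (density (?Y \<Otimes>\<^sub>M ?V) f)" by simp
    fix A assume "A \<in> sets ?J"
    then have A[measurable]: "A \<in> sets (S \<Otimes>\<^sub>M T)" by simp
    have "emeasure ?J A = (\<integral>\<^sup>+x. indicator A (e (Y x), V x) \<partial>M)"
      by (simp add: nn_integral_indicator[symmetric] nn_integral_distr del: nn_integral_indicator)
    also have "\<dots> = (\<integral>\<^sup>+x. indicator A (e (a (V x) + N x), V x) \<partial>M)"
      using Y_eq by (intro nn_integral_cong_AE) auto
    also have "\<dots> = (\<integral>\<^sup>+p. indicator A (e (a (snd p) + fst p), snd p) \<partial>distr M (borel \<Otimes>\<^sub>M T) (\<lambda>x. (N x, V x)))"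
      by (simp add: nn_integral_distr)
    also have "\<dots> = (\<integral>\<^sup>+p. indicator A (e (a (snd p) + fst p), snd p) \<partial>(distr M borel N \<Otimes>\<^sub>M ?V))"
      by (simp add: ind)
    also have "\<dots> = (\<integral>\<^sup>+t. \<integral>\<^sup>+n. indicator A (e (a t + n), t) \<partial>distr M lborel N \<partial>?V)"
    proof -
      have "(\<integral>\<^sup>+p. indicator A (e (a (snd p) + fst p), snd p) \<partial>(distr M borel N \<Otimes>\<^sub>M ?V))
        = (\<integral>\<^sup>+t. \<integral>\<^sup>+n. indicator A (e (a t + n), t) \<partial>distr M borel N \<partial>?V)"
        by (subst Q.nn_integral_snd[symmetric]) auto
      also have "\<dots> = (\<integral>\<^sup>+t. \<integral>\<^sup>+n. indicator A (e (a t + n), t) \<partial>distr M lborel N \<partial>?V)"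
        by (intro nn_integral_cong arg_cong2[of _ _ _ _ nn_integral] distr_cong) auto
      finally show ?thesis .
    qed
    also have "\<dots> = (\<integral>\<^sup>+t. \<integral>\<^sup>+n. ennreal (normal_density 0 (sqrt v) n) * indicator A (e (a t + n), t) \<partial>lborel \<partial>?V)"
      unfolding DN by (intro nn_integral_cong nn_integral_density) auto
    also have "\<dots> = (\<integral>\<^sup>+t. \<integral>\<^sup>+y. ennreal (normal_density 0 (sqrt v) (y - a t)) * indicator A (e y, t) \<partial>lborel \<partial>?V)"
    proof (rule nn_integral_cong)
      fix t assume "t \<in> space ?V"
      then have [measurable]: "t \<in> space T" by simp
      show "(\<integral>\<^sup>+n. ennreal (normal_density 0 (sqrt v) n) * indicator A (e (a t + n), t) \<partial>lborel)
        = (\<integral>\<^sup>+y. ennreal (normal_density 0 (sqrt v) (y - a t)) * indicator A (e y, t) \<partial>lborel)"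
        by (subst nn_integral_real_affine[where c=1 and t="- a t"]) auto
    qed
    also have "\<dots> = (\<integral>\<^sup>+t. \<integral>\<^sup>+y. ennreal (normal_density 0 (sqrt w) y) * (ennreal (f (e y, t)) * indicator A (e y, t)) \<partial>lborel \<partial>?V)"
    proof (intro nn_integral_cong)
      fix t y
      have "normal_density 0 (sqrt w) y > 0" using Y by (intro normal_density_pos) auto
      then show "ennreal (normal_density 0 (sqrt v) (y - a t)) * indicator A (e y, t)
        = ennreal (normal_density 0 (sqrt w) y) * (ennreal (f (e y, t)) * indicator A (e y, t))"
        by (simp add: f_def he ennreal_mult[symmetric] mult.assoc[symmetric])
    qed
    also have "\<dots> = (\<integral>\<^sup>+t. \<integral>\<^sup>+y. ennreal (f (e y, t)) * indicator A (e y, t) \<partial>distr M lborel Y \<partial>?V)"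
      unfolding DY by (intro nn_integral_cong nn_integral_density[symmetric]) auto
    also have "\<dots> = (\<integral>\<^sup>+t. \<integral>\<^sup>+s. ennreal (f (s, t)) * indicator A (s, t) \<partial>?Y \<partial>?V)"
      by (intro nn_integral_cong) (simp add: nn_integral_distr)
    also have "\<dots> = (\<integral>\<^sup>+p. ennreal (f p) * indicator A p \<partial>(?Y \<Otimes>\<^sub>M ?V))"
      by (subst P.nn_integral_snd[symmetric]) auto
    also have "\<dots> = emeasure (density (?Y \<Otimes>\<^sub>M ?V) f) A"
      by (simp add: emeasure_density)
    finally show "emeasure ?J A = emeasure (density (?Y \<Otimes>\<^sub>M ?V) f) A" .
  qed
  have f_nonneg: "0 \<le> f p" for p
    by (auto simp: f_def split: prod.split)
  have "mutual_information b S T (\<lambda>x. e (Y x)) V = (\<integral>p. f p * log b (f p) \<partial>(?Y \<Otimes>\<^sub>M ?V))"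
    unfolding mutual_information_def J
    using b f_nonneg by (intro P.KL_density) auto
  also have "\<dots> = (\<integral>p. log b (f p) \<partial>?J)"
    unfolding J using f_nonneg by (subst integral_density) auto
  also have "\<dots> = expectation (\<lambda>x. log b (f (e (Y x), V x)))"
    by (subst integral_distr) auto
  \<comment> \<open>\<open>f\<close> is a quotient of normal densities at \<open>N x\<close> and
    \<open>Y x\<close>. As \<open>Y\<close> and \<open>N\<close> have second moments
    \<open>w\<close> and \<open>v\<close>, the two quadratic terms have expectation 1/2 each and
    cancel.\<close>
  also have "\<dots> = expectation (\<lambda>x. log b (w / v) / 2 + ((Y x)\<^sup>2 / (2 * w) - (N x)\<^sup>2 / (2 * v)) / ln b)"
    using Y_eq b N Y by (intro integral_cong_AE) (auto simp: f_def he log_normal_density_quotient)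
  also have "\<dots> = log b (w / v) / 2"
    using gaussian_var_second_moment[OF N(2,1)] gaussian_var_second_moment[OF Y(2,1)] N Y
    by (simp add: prob_space)
  finally show ?thesis .
qed

text \<open>The difference of the differential entropies of Gaussians with variances
  \<open>x\<close> and \<open>y\<close>; for \<open>x = y + p\<close> it is the capacity at power
  \<open>p\<close> and noise \<open>y\<close>.\<close>

definition gauss_rate :: "real \<Rightarrow> real \<Rightarrow> real \<Rightarrow> real" where
  "gauss_rate b x y = log b (x / y) / 2"

lemma gauss_rate_self: "0 < x \<Longrightarrow> gauss_rate b x x = 0"
  by (simp add: gauss_rate_def)

lemma gauss_rate_chain:
  "0 < x \<Longrightarrow> 0 < y \<Longrightarrow> 0 < z \<Longrightarrow> gauss_rate b x y + gauss_rate b y z = gauss_rate b x z"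
  by (simp add: gauss_rate_def log_divide field_simps)

lemma gauss_rate_le_iff:
  assumes "1 < b" "0 < x" "0 < y" "0 < x'" "0 < y'"
  shows "gauss_rate b x y \<le> gauss_rate b x' y' \<longleftrightarrow> x * y' \<le> x' * y"
  using assms by (simp add: gauss_rate_def divide_simps mult.commute)

lemma gauss_rate_less_iff:
  assumes "1 < b" "0 < x" "0 < y" "0 < x'" "0 < y'"
  shows "gauss_rate b x y < gauss_rate b x' y' \<longleftrightarrow> x * y' < x' * y"
  using assms by (simp add: gauss_rate_def divide_simps mult.commute)

lemma gauss_rate_nonneg: "1 < b \<Longrightarrow> 0 < y \<Longrightarrow> y \<le> x \<Longrightarrow> 0 \<le> gauss_rate b x y"
  by (simp add: gauss_rate_def)

text \<open>The quotient is \<open>1 + a / y\<close>, which falls as the noise grows.\<close>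

lemma gauss_rate_antimono_noise:
  assumes "1 < b" "0 < x" "x \<le> y" "0 \<le> a"
  shows "gauss_rate b (y + a) y \<le> gauss_rate b (x + a) x"
  using assms by (subst gauss_rate_le_iff) (auto simp: algebra_simps mult_left_mono)

lemma gauss_rate_strict_antimono_noise:
  assumes "1 < b" "0 < x" "x < y" "0 < a"
  shows "gauss_rate b (y + a) y < gauss_rate b (x + a) x"
  using assms by (subst gauss_rate_less_iff) (auto simp: algebra_simps)

lemma gauss_rate_mono:
  assumes "1 < b" "0 < z" "0 < x" "x \<le> y"
  shows "gauss_rate b x z \<le> gauss_rate b y z"
  using assms by (subst gauss_rate_le_iff) auto

subsection \<open>Mutual information at a Gaussian output\<close>

text \<open>\<open>X\<^sub>s\<close> is absent because it is \<open>U + W\<close> almost everywhere;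
  these four and the two noises are the independent components.\<close>

definition src :: "rv set" where "src = {VX T1, VX T2, VU, VW}"

text \<open>
  The tuple in terms of its independent components: an output name stands for the noise at
  that output.
\<close>

definition component :: "(tx \<Rightarrow> real) \<Rightarrow> (tx \<Rightarrow> real) \<Rightarrow> rv \<Rightarrow> (rv \<Rightarrow> real) \<Rightarrow> real" where
  "component gp gs v z =
     (if v = VYp then noise gp VYp z else if v = VYs then noise gs VYs z else z v)"

text \<open>\<open>U\<close> and \<open>W\<close> are both sent by transmitter s. The value 1 is the
  weight of the noise in its own output.\<close>

fun gain :: "(tx \<Rightarrow> real) \<Rightarrow> rv \<Rightarrow> real" where
  "gain g (VX k) = g k"
| "gain g VU = g TS"
| "gain g VW = g TS"
| "gain g _ = 1"

locale gaussian_tuple =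
  fixes gp gs :: "tx \<Rightarrow> real" and N0 :: real and P :: "tx \<Rightarrow> real" and Z :: rvs
  assumes gains: "\<And>k. 0 < gp k" "\<And>k. 0 < gs k"
    and N0: "0 < N0"
    and tuple: "Z \<in> gaussian_rvs gp gs N0 P"
begin

sublocale prob_space Z
  using tuple by (simp add: gaussian_rvs_def)

lemma sets_Z [measurable_cong]: "sets Z = sets (joint_space UNIV)"
  using tuple by (simp add: gaussian_rvs_def)

lemma superposition: "AE z in Z. z (VX TS) = z VU + z VW"
  using tuple by (simp add: gaussian_rvs_def)

lemma input_variance: "variance (\<lambda>z. z (VX k)) = P k"
  using tuple by (simp add: gaussian_rvs_def)

lemma noise_variance: "variance (noise gp VYp) = N0" "variance (noise gs VYs) = N0"
  using tuple by (simp_all add: gaussian_rvs_def)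

lemma coordinate_measurable [measurable]: "(\<lambda>z. z v) \<in> borel_measurable Z"
  by measurable

lemma restrict_measurable [measurable]: "(\<lambda>z. restrict z A) \<in> measurable Z (joint_space A)"
  by measurable

lemma noise_measurable [measurable]: "noise g y \<in> borel_measurable Z"
  unfolding noise_def by measurable

abbreviation part where "part \<equiv> component gp gs"

definition part_var :: "rv \<Rightarrow> real" where "part_var v = variance (part v)"

definition channel :: "rv \<Rightarrow> tx \<Rightarrow> real" where "channel y = (if y = VYp then gp else gs)"

text \<open>The conditional variance of the output \<open>y\<close> given the variables in \<open>A\<close>.\<close>

definition residual :: "rv \<Rightarrow> rv set \<Rightarrow> real" where
  "residual y A = (\<Sum>v\<in>insert y src - A. gain (channel y) v * part_var v)"

lemma part_measurable [measurable]: "part v \<in> borel_measurable Z"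
  unfolding component_def by measurable

lemma part_src: "v \<in> src \<Longrightarrow> part v z = z v"
  by (auto simp: component_def src_def)

lemma part_gaussian:
  assumes "v \<in> src \<union> {VYp, VYs}"
  shows "gaussian_var Z (part v) (part_var v)"
  unfolding part_var_def
  using assms tuple
  by (intro zero_mean_gaussian_imp_gaussian_var)
     (auto simp: src_def component_def[abs_def] gaussian_rvs_def)

lemma part_indep: "indep_vars (\<lambda>_. borel) part (src \<union> {VYp, VYs})"
proof -
  define X where "X = (\<lambda>k. [\<lambda>z. z (VX T1), \<lambda>z. z (VX T2), \<lambda>z. z VU, \<lambda>z. z VW,
              noise gp VYp, noise gs VYs] ! k)"
  \<comment> \<open>Positions in the list of \<open>X\<close>; the value at \<open>VX TS\<close>,
    which is outside \<open>src\<close>, is a dummy. Injectivity on the six relevant names makes the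
    singletons disjoint.\<close>
  define ix :: "rv \<Rightarrow> nat" where "ix = (\<lambda>v. case v of VX T1 \<Rightarrow> 0 | VX T2 \<Rightarrow> 1 | VX TS \<Rightarrow> 0
     | VU \<Rightarrow> 2 | VW \<Rightarrow> 3 | VYp \<Rightarrow> 4 | VYs \<Rightarrow> 5)"
  have "indep_vars (\<lambda>_. borel) X {..<6}"
    using tuple by (simp add: gaussian_rvs_def X_def)
  then have "indep_vars (\<lambda>v. PiM {ix v} (\<lambda>_. borel)) (\<lambda>v z. restrict (\<lambda>k. X k z) {ix v}) (src \<union> {VYp, VYs})"
    by (rule indep_vars_restrict) (auto simp: disjoint_family_on_def src_def ix_def)
  then have "indep_vars (\<lambda>_. borel) (\<lambda>v z. (restrict (\<lambda>k. X k z) {ix v}) (ix v)) (src \<union> {VYp, VYs})"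
    by (rule indep_vars_compose2[where Y="\<lambda>v h. h (ix v)"]) measurable
  also have "?this \<longleftrightarrow> ?thesis"
    by (intro indep_vars_cong) (auto simp: src_def ix_def X_def component_def fun_eq_iff)
  finally show ?thesis .
qed

lemma output_decomposition:
  assumes "y \<in> {VYp, VYs}"
  shows "AE z in Z. z y = (\<Sum>v\<in>insert y src. sqrt (gain (channel y) v) * part v z)"
proof -
  show ?thesis
    using superposition assms
    by (auto simp: src_def channel_def component_def noise_def algebra_simps elim!: eventually_mono)
qed

lemma weighted_sum_gaussian:
  assumes "y \<in> {VYp, VYs}" "B \<subseteq> insert y src"
  shows "gaussian_var Z (\<lambda>z. \<Sum>v\<in>B. sqrt (gain (channel y) v) * part v z)
     (\<Sum>v\<in>B. gain (channel y) v * part_var v)"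
proof (rule gaussian_var_sum)
  have B: "B \<subseteq> src \<union> {VYp, VYs}" using assms by auto
  show "finite B" using assms by (auto simp: src_def intro: finite_subset)
  show "indep_vars (\<lambda>_. borel) (\<lambda>v z. sqrt (gain (channel y) v) * part v z) B"
    by (rule indep_vars_compose2[OF indep_vars_subset[OF part_indep B]]) auto
  fix v assume "v \<in> B"
  moreover have "0 \<le> gain (channel y) v"
    using gains by (cases v) (auto simp: channel_def less_imp_le)
  ultimately show "gaussian_var Z (\<lambda>z. sqrt (gain (channel y) v) * part v z) (gain (channel y) v * part_var v)"
    using gaussian_var_scale[OF part_gaussian, of v "sqrt (gain (channel y) v)"] B by auto
qed

lemma part_var_nonneg: "0 \<le> part_var v"
  by (simp add: part_var_def)

lemma part_var_noise: "y \<in> {VYp, VYs} \<Longrightarrow> part_var y = N0"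
  using noise_variance by (auto simp: part_var_def component_def[abs_def])

lemma part_var_X: "part_var (VX k) = P k"
  using input_variance by (simp add: part_var_def component_def[abs_def])

lemma part_var_U_W: "part_var VU + part_var VW = P TS"
proof -
  have "indep_vars (\<lambda>_. borel) part {VU, VW}"
    by (rule indep_vars_subset[OF part_indep]) (auto simp: src_def)
  then have UW: "gaussian_var Z (\<lambda>z. \<Sum>v\<in>{VU, VW}. part v z) (\<Sum>v\<in>{VU, VW}. part_var v)"
    by (intro gaussian_var_sum part_gaussian) (auto simp: src_def)
  have "AE z in Z. z (VX TS) = (\<Sum>v\<in>{VU, VW}. part v z)"
    using superposition by (simp add: component_def)
  from gaussian_var_variance[OF gaussian_var_cong_AE[OF UW coordinate_measurable this]]
  show ?thesis by (simp add: input_variance)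
qed

text \<open>The noise at \<open>y\<close> is never conditioned on, so it contributes
  \<open>N0\<close>, and the other summands are nonnegative.\<close>

lemma residual_pos:
  assumes "y \<in> {VYp, VYs}" "A \<subseteq> src"
  shows "0 < residual y A"
proof -
  have "0 < gain (channel y) y * part_var y" using assms N0 by (auto simp: part_var_noise)
  also have "\<dots> \<le> residual y A"
    unfolding residual_def
  proof (rule member_le_sum)
    show "y \<in> insert y src - A" using assms by (auto simp: src_def)
    show "finite (insert y src - A)" by (simp add: src_def)
    show "0 \<le> gain (channel y) v * part_var v" for v
      using gains by (cases v) (auto simp: channel_def less_imp_le part_var_nonneg)
  qed
  finally show ?thesis .
qed

text \<open>Signals outside \<open>A\<close> act together with the noise as one Gaussian noise of
  variance \<open>residual y A\<close>. The map \<open>F\<close> recodes what is observed, since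
  conditional information presents two groups of variables as a pair; \<open>a\<close> recovers the
  received sum.\<close>

lemma mutual_information_output:
  assumes b: "1 < b" and y: "y \<in> {VYp, VYs}" and A: "A \<subseteq> src"
    and F: "F \<in> measurable (joint_space A) T" and a[measurable]: "a \<in> borel_measurable T"
    and aF: "\<And>x. a (F x) = (\<Sum>v\<in>A. sqrt (gain (channel y) v) * x v)"
  shows "mutual_information b (joint_space {y}) T (\<lambda>z. restrict z {y}) (\<lambda>z. F (restrict z A))
    = log b (residual y {} / residual y A) / 2"
proof -
  let ?c = "\<lambda>v. sqrt (gain (channel y) v)"
  let ?I = "insert y src"
  have fin: "finite ?I" by (simp add: src_def)
  have FA [measurable]: "(\<lambda>z. F (restrict z A)) \<in> measurable Z T"
    using measurable_compose[OF restrict_measurable F] .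
  define N where "N = (\<lambda>z. \<Sum>v\<in>?I - A. ?c v * part v z)"
  have N: "gaussian_var Z N (residual y A)"
    unfolding N_def residual_def using y by (intro weighted_sum_gaussian) auto
  have [measurable]: "N \<in> borel_measurable Z" by (rule gaussian_var_measurable[OF N])
  have Y: "gaussian_var Z (\<lambda>z. z y) (residual y {})"
    using gaussian_var_cong_AE[OF weighted_sum_gaussian[OF y subset_refl] coordinate_measurable
        output_decomposition[OF y]]
    by (simp add: residual_def)
  have restrict_eq: "restrict (\<lambda>v. part v z) A = restrict z A" for z
    using A by (intro restrict_ext) (use part_src in blast)
  have "indep_var (joint_space (?I - A)) (\<lambda>z. restrict (\<lambda>v. part v z) (?I - A))
      (joint_space A) (\<lambda>z. restrict (\<lambda>v. part v z) A)"
    using A y by (intro indep_var_restrict[OF part_indep]) auto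
  then have ind: "distr Z (joint_space (?I - A)) (\<lambda>z. restrict (\<lambda>v. part v z) (?I - A))
        \<Otimes>\<^sub>M distr Z (joint_space A) (\<lambda>z. restrict z A)
      = distr Z (joint_space (?I - A) \<Otimes>\<^sub>M joint_space A)
          (\<lambda>z. (restrict (\<lambda>v. part v z) (?I - A), restrict z A))"
    by (simp add: indep_var_distribution_eq restrict_eq)
  define s where "s = (\<lambda>x. \<Sum>v\<in>?I - A. ?c v * x v)"
  have s [measurable]: "s \<in> borel_measurable (joint_space (?I - A))"
    unfolding s_def by measurable
  have N_eq: "N = (\<lambda>z. s (restrict (\<lambda>v. part v z) (?I - A)))"
    by (simp add: N_def s_def)
  interpret V: prob_space "distr Z T (\<lambda>z. F (restrict z A))"
    by (rule prob_space_distr) (rule FA)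
  let ?R = "distr Z (joint_space (?I - A)) (\<lambda>z. restrict (\<lambda>v. part v z) (?I - A))"
  let ?Q = "distr Z (joint_space A) (\<lambda>z. restrict z A)"
  have R: "distr Z borel N = distr ?R borel s"
    unfolding N_eq by (subst distr_distr) (auto simp: Fun.comp_def)
  have Q: "distr Z T (\<lambda>z. F (restrict z A)) = distr ?Q T F"
    using F by (subst distr_distr) (auto simp: Fun.comp_def)
  \<comment> \<open>A product measure mapped by \<open>s\<close> and \<open>F\<close> separately is
    the product of the images, so independence passes from the two groups of components to
    \<open>N\<close> and the recoded inputs.\<close>
  have "distr ?R borel s \<Otimes>\<^sub>M distr ?Q T F = distr (?R \<Otimes>\<^sub>M ?Q) (borel \<Otimes>\<^sub>M T) (\<lambda>(x, y). (s x, F y))"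
    using s F V.sigma_finite_measure_axioms unfolding Q[symmetric]
    by (intro pair_measure_distr[of s ?R borel F ?Q T, folded Q]) simp_all
  also have "\<dots> = distr Z (borel \<Otimes>\<^sub>M T) (\<lambda>z. (N z, F (restrict z A)))"
    unfolding ind N_eq using F by (subst distr_distr) (auto simp: Fun.comp_def)
  finally have prod: "distr Z borel N \<Otimes>\<^sub>M distr Z T (\<lambda>z. F (restrict z A))
      = distr Z (borel \<Otimes>\<^sub>M T) (\<lambda>z. (N z, F (restrict z A)))"
    by (subst R, subst Q)
  have AE: "AE z in Z. z y = a (F (restrict z A)) + N z"
    using output_decomposition[OF y]
  proof eventually_elim
    case (elim z)
    have "A \<subseteq> ?I" using A by auto
    then have "(\<Sum>v\<in>?I. ?c v * part v z) = N z + (\<Sum>v\<in>A. ?c v * part v z)"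
      unfolding N_def by (rule sum.subset_diff) (rule fin)
    also have "(\<Sum>v\<in>A. ?c v * part v z) = a (F (restrict z A))"
      unfolding aF using A by (intro sum.cong) (auto simp: part_src)
    finally show ?case using elim by simp
  qed
  have e: "(\<lambda>r. \<lambda>_\<in>{y}. r) \<in> borel \<rightarrow>\<^sub>M joint_space {y}"
    by (intro measurable_restrict) auto
  have h: "(\<lambda>x. x y) \<in> borel_measurable (joint_space {y})"
    by (intro measurable_component_singleton) auto
  have "mutual_information b (joint_space {y}) T (\<lambda>z. (\<lambda>r. \<lambda>_\<in>{y}. r) (z y)) (\<lambda>z. F (restrict z A))
      = log b (residual y {} / residual y A) / 2"
    using b FA a e h _ N residual_pos[OF y A] prod Y residual_pos[OF y] AE
    by (rule mutual_information_additive_gaussian) auto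
  also have "(\<lambda>z. (\<lambda>r. \<lambda>_\<in>{y}. r) (z y)) = (\<lambda>z. restrict z {y})"
    by (intro ext) simp
  finally show ?thesis .
qed

lemma mi_output:
  assumes "1 < b" "y \<in> {VYp, VYs}" "A \<subseteq> src"
  shows "mi b Z {y} A = gauss_rate b (residual y {}) (residual y A)"
  unfolding mi_def gauss_rate_def
  using mutual_information_output[OF assms, of "\<lambda>x. x" _ "\<lambda>x. \<Sum>v\<in>A. sqrt (gain (channel y) v) * x v"]
  by simp

text \<open>The chain rule gives a difference of two terms in which the output variance
  \<open>residual y {}\<close> cancels. Disjointness of \<open>B\<close> and \<open>C\<close> lets
  \<open>?a\<close> count each signal once.\<close>

lemma cmi_output:
  assumes b: "1 < b" and y: "y \<in> {VYp, VYs}" and BC: "B \<subseteq> src" "C \<subseteq> src" "B \<inter> C = {}"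
  shows "cmi b Z {y} B C = gauss_rate b (residual y C) (residual y (B \<union> C))"
proof -
  let ?c = "\<lambda>v. sqrt (gain (channel y) v)"
  have fin: "finite B" "finite C" using BC by (auto simp: src_def intro: finite_subset)
  let ?F = "\<lambda>x::rv \<Rightarrow> real. (restrict x B, restrict x C)"
  let ?a = "\<lambda>(p, q). (\<Sum>v\<in>B. ?c v * p v) + (\<Sum>v\<in>C. ?c v * q v)"
  have "mutual_information b (joint_space {y}) (joint_space B \<Otimes>\<^sub>M joint_space C)
      (\<lambda>z. restrict z {y}) (\<lambda>z. ?F (restrict z (B \<union> C)))
    = log b (residual y {} / residual y (B \<union> C)) / 2"
  proof (rule mutual_information_output[OF b y])
    show "?F \<in> joint_space (B \<union> C) \<rightarrow>\<^sub>M joint_space B \<Otimes>\<^sub>M joint_space C"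
      by (intro measurable_Pair measurable_restrict_subset) auto
    show "?a \<in> borel_measurable (joint_space B \<Otimes>\<^sub>M joint_space C)"
      by measurable
    show "?a (?F x) = (\<Sum>v\<in>B \<union> C. ?c v * x v)" for x
      using fin BC by (simp add: sum.union_disjoint)
  qed (use BC in auto)
  also have "(\<lambda>z. ?F (restrict z (B \<union> C))) = (\<lambda>z::rv \<Rightarrow> real. (restrict z B, restrict z C))"
    by (auto simp: fun_eq_iff)
  finally have "cmi b Z {y} B C = log b (residual y {} / residual y (B \<union> C)) / 2
      - log b (residual y {} / residual y C) / 2"
    using mi_output[OF b y BC(2)] by (simp only: cmi_def conditional_mutual_information_def mi_def gauss_rate_def)
  then show ?thesis
    using b BC y residual_pos[OF y, of C] residual_pos[OF y, of "B \<union> C"] residual_pos[OF y, of "{}"]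
    by (simp add: gauss_rate_def log_divide field_simps)
qed

end

subsection \<open>The rate region as a function of the power split\<close>

text \<open>
  The constraints of \<open>\<R>\<^sub>i\<^sup>r(Z\<^sub>l)\<close> on \<open>(R\<^sub>i, R\<^sub>j, S, T)\<close> in terms of received powers: \<open>A1\<close>, \<open>A2\<close> and
  \<open>A\<close> are those of users \<open>i\<close>, \<open>j\<close> and \<open>s\<close> at the primary receiver; \<open>E\<close> and \<open>C\<close> those of \<open>i\<close>
  and \<open>s\<close> at the secondary receiver, where user \<open>j\<close> is part of the noise power \<open>D\<close>.
\<close>

locale power_budget =
  fixes b N A1 A2 A D E C :: real
  assumes b: "1 < b" and N: "0 < N" and A1: "0 < A1" and A2: "0 < A2" and A: "0 < A"
    and D: "0 < D" and E: "0 < E" and C: "0 < C"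
begin

text \<open>\<open>U\<close> is never decoded at the primary receiver, so the noise there is
  \<open>N + l * A\<close>; counting \<open>W\<close> as signal too gives the power
  \<open>N + A\<close>, since \<open>l * A + (1 - l) * A = A\<close>.\<close>

definition feasible :: "real \<Rightarrow> real \<Rightarrow> real \<Rightarrow> real \<Rightarrow> real \<Rightarrow> bool" where
  "feasible l r1 r2 s t \<longleftrightarrow>
     0 \<le> r1 \<and> 0 \<le> r2 \<and> 0 \<le> s \<and> 0 \<le> t \<and>
     r1 \<le> gauss_rate b (N + l * A + A1) (N + l * A) \<and>
     r2 \<le> gauss_rate b (N + l * A + A2) (N + l * A) \<and>
     t \<le> gauss_rate b (N + A) (N + l * A) \<and>
     r1 + r2 \<le> gauss_rate b (N + l * A + (A1 + A2)) (N + l * A) \<and>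
     r1 + t \<le> gauss_rate b (N + A + A1) (N + l * A) \<and>
     r2 + t \<le> gauss_rate b (N + A + A2) (N + l * A) \<and>
     r1 + r2 + t \<le> gauss_rate b (N + A + (A1 + A2)) (N + l * A) \<and>
     s \<le> gauss_rate b (D + l * C) D \<and>
     t \<le> gauss_rate b (D + (1 - l) * C) D \<and>
     r1 \<le> gauss_rate b (D + E) D \<and>
     s + t \<le> gauss_rate b (D + C) D \<and>
     r1 + s \<le> gauss_rate b (D + E + l * C) D \<and>
     r1 + t \<le> gauss_rate b (D + E + (1 - l) * C) D \<and>
     r1 + s + t \<le> gauss_rate b (D + E + C) D"

definition region :: "real \<Rightarrow> (real \<times> real) set" where
  "region l = {(s + t, r1 + r2) | r1 r2 s t. feasible l r1 r2 s t}"

lemma regionI: "feasible l r1 r2 s t \<Longrightarrow> x = s + t \<Longrightarrow> y = r1 + r2 \<Longrightarrow> (x, y) \<in> region l"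
  by (auto simp: region_def)

lemma regionE:
  assumes "p \<in> region l"
  obtains r1 r2 s t where "feasible l r1 r2 s t" "p = (s + t, r1 + r2)"
  using assms by (auto simp: region_def)

text \<open>A linear image of a closed set need not be closed, but the individual rate bounds
  confine the quadruples to a compact box, so the image is compact.\<close>

lemma closed_region: "closed (region l)"
proof -
  define K where "K = {(r1, r2, s, t). feasible l r1 r2 s t}"
  have "closed K"
    unfolding K_def feasible_def split_def
    by (intro closed_Collect_conj closed_Collect_le continuous_intros)
  moreover have "K \<subseteq> {0..gauss_rate b (N + l * A + A1) (N + l * A)} \<times>
      {0..gauss_rate b (N + l * A + A2) (N + l * A)} \<times>
      {0..gauss_rate b (D + l * C) D} \<times> {0..gauss_rate b (N + A) (N + l * A)}" (is "_ \<subseteq> ?B")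
    by (auto simp: K_def feasible_def)
  moreover have "compact ?B"
    by (intro compact_Times compact_Icc)
  ultimately have "compact K"
    using compact_Int_closed[of ?B K] by (simp add: Int_absorb1)
  then have "compact ((\<lambda>(r1, r2, s, t). (s + t, r1 + r2)) ` K)"
    by (intro compact_continuous_image) (auto simp: split_def intro!: continuous_intros)
  also have "(\<lambda>(r1, r2, s, t). (s + t, r1 + r2)) ` K = region l"
    by (force simp: K_def region_def image_def)
  finally show ?thesis by (rule compact_imp_closed)
qed

text \<open>
  The point \<open>(r1, r2, s, t)\<close> is moved to \<open>(r1, r2, 0, s + t)\<close>: the rate \<open>s\<close> fits into the gap
  that opens at the primary receiver because \<open>U\<close> is no longer noise there.
\<close>

lemma region_subset_region_0:
  assumes l: "0 \<le> l" "l \<le> 1" and strong: "C * N \<le> A * D"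
  shows "region l \<subseteq> region 0"
proof -
  have "feasible 0 r1 r2 0 (s + t)" if f: "feasible l r1 r2 s t" for r1 r2 s t
  proof -
    have Nl: "N \<le> N + l * A" "0 < N + l * A"
      using l N A by (auto intro!: add_pos_nonneg)
    \<comment> \<open>\<open>strong\<close> says \<open>C / D \<le> A / N\<close>; with both powers
      scaled by \<open>l\<close> it bounds the private rate by the gap at the primary
      receiver.\<close>
    have "gauss_rate b (D + l * C) D \<le> gauss_rate b (N + l * A) N"
    proof (subst gauss_rate_le_iff)
      show "(D + l * C) * N \<le> (N + l * A) * D"
        using mult_left_mono[OF strong l(1)] by (simp add: algebra_simps)
    qed (use b N D C l Nl in \<open>auto intro!: add_pos_nonneg\<close>)
    then have s: "s \<le> gauss_rate b (N + l * A) N"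
      using f by (simp add: feasible_def)
    \<comment> \<open>With the received power \<open>x\<close> fixed, lowering the noise to
      \<open>N\<close> adds exactly this gap to each primary bound that contains \<open>t\<close>,
      which makes room for \<open>s\<close>.\<close>
    have chain: "gauss_rate b x (N + l * A) + gauss_rate b (N + l * A) N = gauss_rate b x N" if "0 < x" for x
      using that Nl N by (intro gauss_rate_chain)
    have mono: "gauss_rate b (D + E + (1 - l) * C) D \<le> gauss_rate b (D + E + C) D"
      using b D E C l by (intro gauss_rate_mono) (auto intro!: add_pos_nonneg simp: mult_left_le_one_le)
    note antimono = gauss_rate_antimono_noise[OF b N Nl(1)]
    show ?thesis
      using f s antimono[of A1] antimono[of A2] antimono[of "A1 + A2"] mono
        chain[of "N + A"] chain[of "N + A + A1"] chain[of "N + A + A2"] chain[of "N + A + (A1 + A2)"]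
        N A A1 A2 D gauss_rate_self[of D b]
      unfolding feasible_def by simp
  qed
  then show ?thesis
    by (auto elim!: regionE intro!: regionI)
qed

text \<open>
  The witness has the largest primary rate at \<open>l = 0\<close>. Every bound on it that involves the primary
  receiver strictly decreases when \<open>U\<close> adds noise there.
\<close>

lemma region_0_not_subset:
  assumes l: "0 < l"
  shows "\<not> region 0 \<subseteq> region l"
proof
  assume sub: "region 0 \<subseteq> region l"
  define a1 where "a1 = gauss_rate b (N + A1) N"
  define a2 where "a2 = gauss_rate b (N + A2) N"
  define a12 where "a12 = gauss_rate b (N + (A1 + A2)) N"
  define e where "e = gauss_rate b (D + E) D"
  \<comment> \<open>A corner point: with user s silent, first the largest rate of user i that both
    receivers allow, then the largest rate of user j that remains.\<close>
  define r1 where "r1 = min a1 e"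
  define r2 where "r2 = min a2 (a12 - r1)"
  have nonneg: "0 \<le> a1" "0 \<le> a2" "0 \<le> e"
    unfolding a1_def a2_def e_def using b N D E A1 A2 by (auto intro!: gauss_rate_nonneg)
  have a1_le: "a1 \<le> a12"
    unfolding a1_def a12_def using b N A1 A2 by (intro gauss_rate_mono) auto
  have more: "a1 \<le> gauss_rate b (N + A + A1) N" "a2 \<le> gauss_rate b (N + A + A2) N"
      "a12 \<le> gauss_rate b (N + A + (A1 + A2)) N" "0 \<le> gauss_rate b (N + A) N"
      "e \<le> gauss_rate b (D + E + C) D" "0 \<le> gauss_rate b (D + C) D"
    unfolding a1_def a2_def a12_def e_def using b N A A1 A2 D E C
    by (auto intro!: gauss_rate_mono gauss_rate_nonneg)
  have "feasible 0 r1 r2 0 0"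
    using nonneg a1_le more D gauss_rate_self[of D b]
    unfolding feasible_def
    by (auto simp: r1_def r2_def simp flip: a1_def a2_def a12_def e_def)
  then have "(0, r1 + r2) \<in> region l"
    using sub by (auto dest: regionI)
  then obtain q1 q2 s t where q: "feasible l q1 q2 s t" "r1 + r2 = q1 + q2"
    by (auto simp: region_def)
  have Nl: "N < N + l * A" using l A by simp
  note antimono = gauss_rate_strict_antimono_noise[OF b N Nl]
  have "q1 < a1" "q2 < a2" "q1 + q2 < a12" "q1 \<le> e"
    using q(1) antimono[of A1] antimono[of A2] antimono[of "A1 + A2"] A1 A2
    unfolding feasible_def a1_def a2_def a12_def e_def by auto
  \<comment> \<open>\<open>r1 + r2\<close> is the minimum of \<open>a1 + a2\<close>,
    \<open>e + a2\<close> and \<open>a12\<close>. Only the bound by \<open>e\<close> is not strict,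
    and there \<open>q2 < a2\<close> supplies the strictness.\<close>
  then show False
    using q(2) by (auto simp: r1_def r2_def min_def split: if_splits)
qed

lemma region_1_not_subset_region_0:
  assumes weak: "A * D < C * N"
  shows "\<not> region 1 \<subseteq> region 0"
proof
  assume sub: "region 1 \<subseteq> region 0"
  let ?c = "gauss_rate b (D + C) D"
  have "0 \<le> ?c" "?c \<le> gauss_rate b (D + E + C) D" "0 \<le> gauss_rate b (D + E) D"
    using b C D E by (auto intro!: gauss_rate_nonneg gauss_rate_mono)
  moreover have "0 \<le> gauss_rate b (N + A + x) (N + A)" if "0 \<le> x" for x
    using that b N A by (auto intro!: gauss_rate_nonneg)
  ultimately have "feasible 1 0 0 ?c 0"
    using A1 A2 N A D gauss_rate_self[of D b] gauss_rate_self[of "N + A" b]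
    unfolding feasible_def by simp
  then have "(?c, 0) \<in> region 0"
    using sub by (auto dest: regionI)
  then obtain r1 r2 s t where f: "feasible 0 r1 r2 s t" "?c = s + t"
    by (auto simp: region_def)
  \<comment> \<open>At \<open>l = 0\<close> the bound on \<open>s\<close> is 0, so all of
    \<open>?c\<close> is carried by \<open>t\<close>, which the primary receiver must
    decode.\<close>
  then have "?c \<le> gauss_rate b (N + A) N"
    using D gauss_rate_self[of D b] unfolding feasible_def by simp
  then show False
    using b N A D C weak by (simp add: gauss_rate_le_iff algebra_simps)
qed

end

section \<open>Transport of Gaussian tuples along measurable maps\<close>

lemma (in prob_space) zero_mean_gaussian_distr:
  assumes [measurable]: "f \<in> measurable M N" "V \<in> borel_measurable N"
    and V: "zero_mean_gaussian M (\<lambda>x. V (f x))"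
  shows "zero_mean_gaussian (distr M N f) V"
  using V unfolding zero_mean_gaussian_def
proof (elim disj_forward ex_forward conj_forward)
  assume "AE x in M. V (f x) = 0"
  then show "AE x in distr M N f. V x = 0"
    by (subst AE_distr_iff) auto
next
  fix \<sigma>
  assume "distributed M lborel (\<lambda>x. V (f x)) (normal_density 0 \<sigma>)"
  then show "distributed (distr M N f) lborel V (normal_density 0 \<sigma>)"
    by (auto simp: distributed_def distr_distr comp_def)
qed

lemma (in prob_space) indep_vars_distr:
  assumes f[measurable]: "f \<in> measurable M N" and I: "I \<noteq> {}"
    and X[measurable]: "\<And>i. i \<in> I \<Longrightarrow> X i \<in> measurable N (M' i)"
    and ind: "indep_vars M' (\<lambda>i x. X i (f x)) I"
  shows "prob_space.indep_vars (distr M N f) M' X I"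
proof -
  interpret D: prob_space "distr M N f" by (rule prob_space_distr) (rule f)
  have rv: "random_variable (M' i) (\<lambda>x. X i (f x))" if "i \<in> I" for i
    using measurable_compose[OF f X[OF that]] .
  have "distr (distr M N f) (Pi\<^sub>M I M') (\<lambda>x. \<lambda>i\<in>I. X i x) = distr M (Pi\<^sub>M I M') (\<lambda>x. \<lambda>i\<in>I. X i (f x))"
    by (subst distr_distr) (auto simp: comp_def intro!: measurable_restrict X f)
  also have "\<dots> = (\<Pi>\<^sub>M i\<in>I. distr M (M' i) (\<lambda>x. X i (f x)))"
    using ind by (subst (asm) indep_vars_iff_distr_eq_PiM'[OF I rv]) auto
  also have "\<dots> = (\<Pi>\<^sub>M i\<in>I. distr (distr M N f) (M' i) (X i))"
    by (intro PiM_cong refl) (subst distr_distr, auto simp: comp_def intro!: X f)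
  finally show ?thesis
    using X by (subst D.indep_vars_iff_distr_eq_PiM'[OF I]) auto
qed

context gaussian_tuple
begin

text \<open>
  Replacing one of \<open>U\<close>, \<open>W\<close> by \<open>U + W\<close> and the other one by 0 leaves \<open>X\<^sub>s\<close>, the outputs and
  the noises untouched.
\<close>

lemma reallocate:
  obtains Z' where "Z' \<in> gaussian_rvs gp gs N0 P"
    "prob_space.variance Z' (\<lambda>z. z VU) = (if all_U then P TS else 0)"
proof -
  define \<phi> :: "(rv \<Rightarrow> real) \<Rightarrow> rv \<Rightarrow> real" where
    "\<phi> = (\<lambda>z v. if v = VU then (if all_U then z VU + z VW else 0)
            else if v = VW then (if all_U then 0 else z VU + z VW) else z v)"
  define Z' where "Z' = distr Z (joint_space UNIV) \<phi>"
  define X where "X = (\<lambda>k. [\<lambda>z. z (VX T1), \<lambda>z. z (VX T2), \<lambda>z. z VU, \<lambda>z. z VW,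
              noise gp VYp, noise gs VYs] ! k)"
  \<comment> \<open>\<open>X k\<close> after \<open>\<phi>\<close> is the sum of the components in
    \<open>K k\<close>, the empty block giving the constant 0. Disjoint blocks of independent
    components are independent.\<close>
  define K where "K = (\<lambda>k::nat. [{VX T1}, {VX T2}, if all_U then {VU, VW} else {},
              if all_U then {} else {VU, VW}, {VYp}, {VYs}] ! k)"
  have less6: "k < 6 \<longleftrightarrow> k \<in> {0, 1, 2, 3, 4, 5}" for k :: nat
    by auto
  have \<phi> [measurable]: "\<phi> \<in> Z \<rightarrow>\<^sub>M joint_space UNIV"
  proof (rule measurable_PiM_single')
    show "(\<lambda>z. \<phi> z v) \<in> borel_measurable Z" for v
      unfolding \<phi>_def by measurable
  qed (simp_all add: space_PiM)
  interpret Z': prob_space Z'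
    unfolding Z'_def by (rule prob_space_distr) (rule \<phi>)
  have noise_meas: "noise g y \<in> borel_measurable (joint_space UNIV)" for g y
    unfolding noise_def by measurable
  have X_meas: "X k \<in> borel_measurable (joint_space UNIV)" if "k < 6" for k
    using that unfolding less6 by (auto simp: X_def noise_meas)
  have noise_\<phi>: "noise g y (\<phi> z) = noise g y z" if "y \<in> {VYp, VYs}" for g y z
    using that by (auto simp: noise_def \<phi>_def)
  have X_\<phi>: "X k (\<phi> z) = (\<Sum>v\<in>K k. part v z)" if "k < 6" for k z
    using that unfolding less6
    by (auto simp: X_def K_def noise_\<phi> component_def) (auto simp: \<phi>_def)
  have K_sub: "K k \<subseteq> src \<union> {VYp, VYs}" if "k < 6" for k
    using that unfolding less6 by (auto simp: K_def src_def)
  have K_disj: "disjoint_family_on K {..<6}"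
  proof -
    have "{..<6} = {0, 1, 2, 3, 4, 5 :: nat}" by auto
    then show ?thesis by (simp add: disjoint_family_on_def K_def)
  qed
  have K_fin: "finite (K k)" if "k < 6" for k
    using K_sub[OF that] by (rule finite_subset) (simp add: src_def)
  have "indep_vars (\<lambda>k. joint_space (K k)) (\<lambda>k z. restrict (\<lambda>v. part v z) (K k)) {..<6}"
    using K_sub by (intro indep_vars_restrict[OF part_indep _ K_disj]) auto
  then have "indep_vars (\<lambda>_. borel) (\<lambda>k z. \<Sum>v\<in>K k. (restrict (\<lambda>v. part v z) (K k)) v) {..<6}"
    by (rule indep_vars_compose2[where Y="\<lambda>k h. \<Sum>v\<in>K k. h v"]) measurable
  also have "?this \<longleftrightarrow> indep_vars (\<lambda>_. borel) (\<lambda>k z. X k (\<phi> z)) {..<6}"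
    by (intro indep_vars_cong) (auto simp: X_\<phi>)
  finally have ind: "prob_space.indep_vars Z' (\<lambda>_. borel) X {..<6}"
    unfolding Z'_def using X_meas by (intro indep_vars_distr) (auto simp: lessThan_empty_iff)
  have gauss: "gaussian_var Z (\<lambda>z. X k (\<phi> z)) (\<Sum>v\<in>K k. part_var v)" if "k < 6" for k
    unfolding X_\<phi>[OF that]
    using K_fin[OF that] K_sub[OF that]
    by (intro gaussian_var_sum part_gaussian indep_vars_subset[OF part_indep]) auto
  have gaussX: "zero_mean_gaussian Z' (X k)" if "k < 6" for k
    unfolding Z'_def using that X_meas gauss
    by (intro zero_mean_gaussian_distr) (auto intro: gaussian_var_imp_zero_mean_gaussian)
  have variance': "Z'.variance V = variance (\<lambda>z. V (\<phi> z))"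
    if [measurable]: "V \<in> borel_measurable (joint_space UNIV)" for V :: "(rv \<Rightarrow> real) \<Rightarrow> real"
    unfolding Z'_def by (simp add: integral_distr)
  have "AE z in Z'. z (VX TS) = z VU + z VW"
    unfolding Z'_def
  proof (subst AE_distr_iff[OF \<phi>])
    show "{z \<in> space (joint_space UNIV). z (VX TS) = z VU + z VW} \<in> sets (joint_space UNIV)"
      by measurable
    show "AE z in Z. \<phi> z (VX TS) = \<phi> z VU + \<phi> z VW"
      using superposition by (auto simp: \<phi>_def)
  qed
  moreover have "Z'.variance (\<lambda>z. z (VX k)) = P k" for k
    by (subst variance') (auto simp: \<phi>_def input_variance)
  moreover have "Z'.variance (noise gp VYp) = N0" "Z'.variance (noise gs VYs) = N0"
    using noise_meas noise_variance by (simp_all add: variance' noise_\<phi>)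
  ultimately have "Z' \<in> gaussian_rvs gp gs N0 P"
    using ind gaussX[of 0] gaussX[of 1] gaussX[of 2] gaussX[of 3] gaussX[of 4] gaussX[of 5] Z'.prob_space_axioms
    unfolding gaussian_rvs_def by (simp add: X_def) (simp add: Z'_def)
  moreover have "Z'.variance (\<lambda>z. z VU) = (if all_U then P TS else 0)"
    using gaussian_var_variance[OF gauss[of 2]] part_var_U_W
    by (subst variance') (auto simp: X_def K_def)
  ultimately show thesis by (rule that)
qed

section \<open>Rate bounds in terms of received powers\<close>

lemma part_var_W: "part_var VW = P TS - part_var VU"
  using part_var_U_W by simp

lemma src_Diff: "finite (src - A)" "y \<in> {VYp, VYs} \<Longrightarrow> y \<notin> src - A"
  by (auto simp: src_def)

lemma residual_eq:
  assumes "y \<in> {VYp, VYs}" "A \<subseteq> src"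
  shows "residual y A = N0 + (\<Sum>v\<in>src - A. gain (channel y) v * part_var v)"
proof -
  have "insert y src - A = insert y (src - A)" using assms by (auto simp: src_def)
  then show ?thesis
    using assms src_Diff by (auto simp: residual_def part_var_noise)
qed

lemma src_eq: "i \<in> {T1, T2} \<Longrightarrow> j \<in> {T1, T2} \<Longrightarrow> j \<noteq> i \<Longrightarrow> src = {VX i, VX j, VU, VW}"
  by (auto simp: src_def)

text \<open>Each value compares two residual variances, found by adding the received powers of the
  variables not conditioned on. The last item is the left side of the inequality in the
  theorem.\<close>

lemma rates:
  assumes b: "1 < b" and ij: "i \<in> {T1, T2}" "j \<in> {T1, T2}" "j \<noteq> i"
    and U: "part_var VU = l * P TS"
  defines "N \<equiv> N0 + l * (gp TS * P TS)" and "M \<equiv> N0 + gp TS * P TS"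
    and "D \<equiv> N0 + gs j * P j" and "C \<equiv> gs TS * P TS"
  shows "cmi b Z {VYp} {VX i} {VW, VX j} = gauss_rate b (N + gp i * P i) N"
    and "cmi b Z {VYp} {VX j} {VW, VX i} = gauss_rate b (N + gp j * P j) N"
    and "cmi b Z {VYp} {VW} {VX i, VX j} = gauss_rate b M N"
    and "cmi b Z {VYp} {VX i, VX j} {VW} = gauss_rate b (N + (gp i * P i + gp j * P j)) N"
    and "cmi b Z {VYp} {VW, VX i} {VX j} = gauss_rate b (M + gp i * P i) N"
    and "cmi b Z {VYp} {VW, VX j} {VX i} = gauss_rate b (M + gp j * P j) N"
    and "mi b Z {VYp} {VW, VX i, VX j} = gauss_rate b (M + (gp i * P i + gp j * P j)) N"
    and "cmi b Z {VYs} {VU} {VW, VX i} = gauss_rate b (D + l * C) D"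
    and "cmi b Z {VYs} {VW} {VU, VX i} = gauss_rate b (D + (1 - l) * C) D"
    and "cmi b Z {VYs} {VX i} {VU, VW} = gauss_rate b (D + gs i * P i) D"
    and "cmi b Z {VYs} {VU, VW} {VX i} = gauss_rate b (D + C) D"
    and "cmi b Z {VYs} {VU, VX i} {VW} = gauss_rate b (D + gs i * P i + l * C) D"
    and "cmi b Z {VYs} {VW, VX i} {VU} = gauss_rate b (D + gs i * P i + (1 - l) * C) D"
    and "mi b Z {VYs} {VU, VW, VX i} = gauss_rate b (D + gs i * P i + C) D"
    and "cmi b Z {VYs} {VW} {VX i} = gauss_rate b (D + C) (D + l * C)"
  using ij(3) ij(3)[symmetric]
  by (simp_all add: cmi_output[OF b] mi_output[OF b] residual_eq src_eq[OF ij] insert_Diff_if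
      channel_def part_var_X part_var_W U N_def M_def D_def C_def algebra_simps)

lemma rate_region_eq:
  assumes b: "1 < b" and P: "\<And>k. 0 < P k"
    and ij: "i \<in> {T1, T2}" "j \<in> {T1, T2}" "j \<noteq> i"
    and U: "part_var VU = l * P TS"
  shows "rate_region b i Z = power_budget.region b N0 (gp i * P i) (gp j * P j) (gp TS * P TS)
    (N0 + gs j * P j) (gs i * P i) (gs TS * P TS) l"
proof -
  interpret B: power_budget b N0 "gp i * P i" "gp j * P j" "gp TS * P TS"
    "N0 + gs j * P j" "gs i * P i" "gs TS * P TS"
    using b N0 P gains by unfold_locales (auto intro!: add_pos_pos)
  have "rate_region b i Z = {(S + T, R i + R j) | (R :: tx \<Rightarrow> real) S T. B.feasible l (R i) (R j) S T}"
  proof -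
    note r = rates[OF b ij U]
    consider "i = T1" "j = T2" | "i = T2" "j = T1" using ij by auto
    then show ?thesis
    proof cases
      case 1
      show ?thesis
        unfolding rate_region_def B.feasible_def unfolding 1 r[unfolded 1] by (rule refl)
    next
      case 2
      have comm: "R T2 + R T1 = R T1 + R T2" for R :: "tx \<Rightarrow> real"
        by (rule add.commute)
      have insert_comm: "{VX T2, VX T1} = {VX T1, VX T2}" "{VW, VX T2, VX T1} = {VW, VX T1, VX T2}"
        by auto
      show ?thesis
        unfolding rate_region_def B.feasible_def unfolding 2 r[unfolded 2 insert_comm] comm
        by (intro Collect_cong ex_cong1) blast
    qed
  qed
  also have "\<dots> = B.region l"
  proof (intro equalityI subsetI)
    fix p assume "p \<in> B.region l"
    then obtain r1 r2 s t where "B.feasible l r1 r2 s t" "p = (s + t, r1 + r2)"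
      by (rule B.regionE)
    then show "p \<in> {(S + T, R i + R j) | (R :: tx \<Rightarrow> real) S T. B.feasible l (R i) (R j) S T}"
      using ij by (intro CollectI exI[of _ "\<lambda>k. if k = i then r1 else r2"] exI[of _ s] exI[of _ t]) auto
  qed (auto intro: B.regionI)
  finally show ?thesis .
qed

end

section \<open>Comparison of the Gaussian regions over all power splits\<close>

theorem theorem8:
  fixes gp gs P :: "tx \<Rightarrow> real" and N0 b l :: real and i j :: tx and Z :: rvs
  assumes base: "1 < b"
    and gains: "\<And>k. 0 < gp k" "\<And>k. 0 < gs k"
    and powers: "\<And>k. 0 < P k"
    and noise_var: "0 < N0"
    and users: "i \<in> {T1, T2}" "j \<in> {T1, T2}" "j \<noteq> i"
    and lam: "l \<in> {0..1}"
    and Z: "Z \<in> gaussian_rvs gp gs N0 P"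
    and var_U: "prob_space.variance Z (\<lambda>z. z VU) = l * P TS"
    and var_W: "prob_space.variance Z (\<lambda>z. z VW) = (1 - l) * P TS"
  shows "(rate_region b i Z = gaussian_region b i gp gs N0 P \<longleftrightarrow>
            l = 0 \<and> cmi b Z {VYs} {VW} {VX i} \<le> cmi b Z {VYp} {VW} {VX T1, VX T2})
       \<and> (l = 0 \<longrightarrow>
            (cmi b Z {VYs} {VW} {VX i} \<le> cmi b Z {VYp} {VW} {VX T1, VX T2} \<longleftrightarrow>
             gs TS * N0 \<le> gp TS * (gs j * P j + N0)))"
proof -
  interpret B: power_budget b N0 "gp i * P i" "gp j * P j" "gp TS * P TS"
    "N0 + gs j * P j" "gs i * P i" "gs TS * P TS"
    using base noise_var powers gains by unfold_locales (auto intro!: add_pos_pos)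
  have tuple: "gaussian_tuple gp gs N0 P Z'" if "Z' \<in> gaussian_rvs gp gs N0 P" for Z'
    using that gains noise_var by unfold_locales
  interpret Z: gaussian_tuple gp gs N0 P Z
    using tuple[OF Z] .
  have region: "rate_region b i Z' = B.region l'"
    if "Z' \<in> gaussian_rvs gp gs N0 P" "prob_space.variance Z' (\<lambda>z. z VU) = l' * P TS" for Z' l'
  proof -
    interpret Z': gaussian_tuple gp gs N0 P Z' using tuple[OF that(1)] .
    show ?thesis
      using Z'.rate_region_eq[OF base powers users, of l'] that(2)
      by (simp add: Z'.part_var_def component_def[abs_def])
  qed
  have in_G: "B.region l' \<subseteq> gaussian_region b i gp gs N0 P"
    if "Z' \<in> gaussian_rvs gp gs N0 P" "prob_space.variance Z' (\<lambda>z. z VU) = l' * P TS" for Z' l'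
    unfolding gaussian_region_def region[OF that, symmetric]
    using UN_upper[OF that(1)] closure_subset by (rule order_trans)
  have strong_iff: "gs TS * P TS * N0 \<le> gp TS * P TS * (N0 + gs j * P j) \<longleftrightarrow>
      gs TS * N0 \<le> gp TS * (gs j * P j + N0)"
    using mult_le_cancel_left_pos[OF powers[of TS], of "gs TS * N0" "gp TS * (gs j * P j + N0)"]
    by (simp add: algebra_simps)
  have U: "Z.part_var VU = l * P TS"
    using var_U by (simp add: Z.part_var_def component_def[abs_def])
  have cond: "cmi b Z {VYs} {VW} {VX i} \<le> cmi b Z {VYp} {VW} {VX T1, VX T2} \<longleftrightarrow>
      gs TS * N0 \<le> gp TS * (gs j * P j + N0)" if "l = 0"
  proof -
    have "cmi b Z {VYs} {VW} {VX i} = gauss_rate b (N0 + gs j * P j + gs TS * P TS) (N0 + gs j * P j)"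
      using Z.rates(15)[OF base users U] that by simp
    moreover have "cmi b Z {VYp} {VW} {VX T1, VX T2} = gauss_rate b (N0 + gp TS * P TS) N0"
      using Z.rates(3)[OF base users U] users that by (auto simp: insert_commute)
    ultimately have "cmi b Z {VYs} {VW} {VX i} \<le> cmi b Z {VYp} {VW} {VX T1, VX T2} \<longleftrightarrow>
        (N0 + gs j * P j + gs TS * P TS) * N0 \<le> (N0 + gp TS * P TS) * (N0 + gs j * P j)"
      using B.N B.A B.D B.C base by (simp add: gauss_rate_le_iff)
    also have "\<dots> \<longleftrightarrow> gs TS * P TS * N0 \<le> gp TS * P TS * (N0 + gs j * P j)"
      by (simp add: algebra_simps)
    finally show ?thesis by (simp only: strong_iff)
  qed
  have "rate_region b i Z = gaussian_region b i gp gs N0 P \<longleftrightarrow>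
      l = 0 \<and> gs TS * N0 \<le> gp TS * (gs j * P j + N0)"
  proof
    assume eq: "rate_region b i Z = gaussian_region b i gp gs N0 P"
    \<comment> \<open>Reallocation provides tuples for both extreme splits, so equality forces
      \<open>B.region 0\<close> and \<open>B.region 1\<close> into \<open>B.region l\<close>. The
      first inclusion excludes \<open>0 < l\<close>, the second then excludes the reverse strict
      inequality.\<close>
    obtain Z0 where "Z0 \<in> gaussian_rvs gp gs N0 P" "prob_space.variance Z0 (\<lambda>z. z VU) = 0"
      using Z.reallocate[of False] by auto
    then have sub0: "B.region 0 \<subseteq> B.region l"
      using in_G[of Z0 0] eq region[OF Z var_U] by simp
    obtain Z1 where "Z1 \<in> gaussian_rvs gp gs N0 P" "prob_space.variance Z1 (\<lambda>z. z VU) = P TS"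
      using Z.reallocate[of True] by auto
    then have sub1: "B.region 1 \<subseteq> B.region l"
      using in_G[of Z1 1] eq region[OF Z var_U] by simp
    have "l = 0"
      using B.region_0_not_subset[of l] sub0 lam by force
    moreover from this have "gs TS * P TS * N0 \<le> gp TS * P TS * (N0 + gs j * P j)"
      using B.region_1_not_subset_region_0 sub1 by force
    ultimately show "l = 0 \<and> gs TS * N0 \<le> gp TS * (gs j * P j + N0)"
      by (simp only: strong_iff)
  next
    assume strong: "l = 0 \<and> gs TS * N0 \<le> gp TS * (gs j * P j + N0)"
    have "rate_region b i Z' \<subseteq> B.region 0" if Z': "Z' \<in> gaussian_rvs gp gs N0 P" for Z'
    proof -
      interpret Z': gaussian_tuple gp gs N0 P Z' using tuple[OF Z'] .
      \<comment> \<open>The private share of an arbitrary tuple; it lies in [0, 1] because the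
        variances of \<open>U\<close> and \<open>W\<close> add up to \<open>P TS\<close>.\<close>
      define l' where "l' = Z'.part_var VU / P TS"
      have l': "0 \<le> l'" "l' \<le> 1"
        using powers[of TS] Z'.part_var_U_W Z'.part_var_nonneg[of VU] Z'.part_var_nonneg[of VW]
        by (auto simp: l'_def)
      have "rate_region b i Z' = B.region l'"
        using Z'.rate_region_eq[OF base powers users, of l'] powers[of TS] by (simp add: l'_def)
      then show ?thesis
        using B.region_subset_region_0[OF l'] strong strong_iff by simp
    qed
    then have "(\<Union>Z\<in>gaussian_rvs gp gs N0 P. rate_region b i Z) \<subseteq> B.region 0"
      by (rule UN_least)
    then have "gaussian_region b i gp gs N0 P \<subseteq> B.region 0"
      unfolding gaussian_region_def by (rule closure_minimal) (rule B.closed_region)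
    then show "rate_region b i Z = gaussian_region b i gp gs N0 P"
      using in_G[OF Z var_U] region[OF Z var_U] strong by auto
  qed
  then show ?thesis using cond by blast
qed

end
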